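(* Let $X$ be a finite set. 1. Let $f:2^X\to\mathbb{R}$ be a strongly submodular function. Then $(X,\delta)$ given by $\delta(\emptyset)=0$ and $$\delta(A)=f(A)-\min\{f(\{a\}):a\in A\}\qquad(\emptyset\ne A\subseteq X)$$ is a diversity of negative type. 2. Fix $x\in X$. Let $g:2^{X\setminus\{x\}}\to\mathbb{R}$ be a strongly submodular function with $g(\emptyset)=0$. Then $(X,\widehat{\delta})$ given, for $A\subseteq X$, by $$\widehat{\delta}(A)=\begin{cases}g(A\setminus\{x\})&\text{if }x\in A;\\ g(A)-\min\{g(\{a\}):a\in A\}&\text{if }A\ne\emptyset\text{ and }x\notin A;\\ 0&\text{if }A=\emptyset,\end{cases}$$ is a diversity of negative type.
   Context: A diversity is a pair $(X,\delta)$ where $X$ is a set and $\delta$ is a real-valued function on finite subsets of $X$ satisfying (D1') $\delta(A)=0$ if $|A|\le 1$, and (D2) $\delta(A\cup C)\le \delta(A\cup B)+\delta(B\cup C)$ for all finite $A,B,C\subseteq X$ with $B\neq\emptyset$. (So $\delta$ may vanish on sets with two or more elements.) For finite $X$, a diversity $(X,\delta)$ has negative type if $\sum_{A,B\subseteq X}\mathbf{x}_A\mathbf{x}_B\,\delta(A\cup B)\le 0$ for all real vectors $\mathbf{x}$ indexed by subsets of $X$ with $\mathbf{x}_\emptyset=0$ and $\sum_{A\ne\emptyset}\mathbf{x}_A=0$. For a finite set $Z$, a function $f:2^Z\to\mathbb{R}$ is strongly submodular if $$\sum_{K\subseteq\{1,\ldots,m\}}(-1)^{|K|}f\Big(A_0\cup\bigcup_{i\in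 K}A_i\Big)\le 0$$ for all $m\ge 1$ and all $A_0,A_1,\ldots,A_m\in 2^Z$. *)

theory Defs
  imports Complex_Main
begin

locale diversity =
  fixes X :: "'a set" and \<delta> :: "'a set \<Rightarrow> real"
  assumes D1: "\<And>A. \<lbrakk>finite A; A \<subseteq> X; card A \<le> 1\<rbrakk> \<Longrightarrow> \<delta> A = 0"
    and D2: "\<And>A B C. \<lbrakk>finite A; A \<subseteq> X; finite B; B \<subseteq> X; finite C; C \<subseteq> X; B \<noteq> {}\<rbrakk>
      \<Longrightarrow> \<delta> (A \<union> C) \<le> \<delta> (A \<union> B) + \<delta> (B \<union> C)"

(* Only meaningful for finite X: both sums range over Pow X. *)
definition negative_type :: "'a set \<Rightarrow> ('a set \<Rightarrow> real) \<Rightarrow> bool" where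
  "negative_type X \<delta> \<longleftrightarrow>
    (\<forall>x :: 'a set \<Rightarrow> real. x {} = 0 \<and> (\<Sum>A\<in>Pow X - {{}}. x A) = 0 \<longrightarrow>
      (\<Sum>A\<in>Pow X. \<Sum>B\<in>Pow X. x A * x B * \<delta> (A \<union> B)) \<le> 0)"

definition strongly_submodular :: "'a set \<Rightarrow> ('a set \<Rightarrow> real) \<Rightarrow> bool" where
  "strongly_submodular Z f \<longleftrightarrow>
    (\<forall>m\<ge>1. \<forall>A :: nat \<Rightarrow> 'a set. (\<forall>i\<le>m. A i \<subseteq> Z) \<longrightarrow>
      (\<Sum>K\<in>Pow {1..m}. (-1) ^ card K * f (A 0 \<union> (\<Union>i\<in>K. A i))) \<le> 0)"

definition delta :: "('a set \<Rightarrow> real) \<Rightarrow> 'a set \<Rightarrow> real" where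
  "delta f A = (if A = {} then 0 else f A - Min ((\<lambda>a. f {a}) ` A))"

definition delta_hat :: "'a \<Rightarrow> ('a set \<Rightarrow> real) \<Rightarrow> 'a set \<Rightarrow> real" where
  "delta_hat x g A =
    (if x \<in> A then g (A - {x})
     else if A \<noteq> {} then g A - Min ((\<lambda>a. g {a}) ` A)
     else 0)"

end

theory Submission
  imports Defs
begin

text \<open>
  Moebius inversion over the subsets of a finite set \<open>X\<close> writes any set function as
  \<open>f A = (\<Sum>U. h U * [A \<subseteq> U])\<close>, and the coefficient \<open>h U\<close> is exactly one of the alternating
  sums in the definition of strong submodularity (start at \<open>U\<close> and add the points outside \<open>U\<close>
  one by one).  Strong submodularity thus gives \<open>h U \<le> 0\<close> for every proper subset \<open>U\<close>; see
  \<open>strongly_submodular_superset_expansion\<close>.  Because \<open>[A \<union> B \<subseteq> U] = [A \<subseteq> U] [B \<subseteq> U]\<close>, the quadratic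
  form of \<open>f (A \<union> B)\<close> is the sum over \<open>U\<close> of \<open>h U\<close> times the square of \<open>\<Sum>A\<subseteq>U. x A\<close>.  The term for \<open>U = X\<close>,
  whose coefficient has no sign, drops out for coefficient vectors of total sum zero, and the form
  is nonpositive.

  The correction term satisfies \<open>\<mu> (A \<union> B) = min (\<mu> A) (\<mu> B)\<close>, where \<open>\<mu> A\<close> is the minimum of \<open>f\<close> over
  the points of \<open>A\<close>, and the kernel \<open>min\<close> is positive semidefinite on vectors of sum zero
  (\<open>min_kernel_nonneg_of_sum_zero\<close>).  Subtracting it therefore keeps the quadratic form
  nonpositive, which gives negative type.  The triangle inequality follows from \<open>f\<close> being monotone and
  submodular: the instances of strong submodularity with one and two added sets.

  The second construction is an instance of the first.  Extend \<open>g\<close> to the subsets of \<open>X\<close> by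
  \<open>f A = g (A - {x})\<close>.  This \<open>f\<close> is again strongly submodular, nonnegative since \<open>g {} = 0\<close>, and zero
  at the point \<open>x\<close>; so the minimum over a set containing \<open>x\<close> is \<open>0\<close>, and \<open>delta_hat x g\<close> coincides
  with \<open>delta f\<close>.
\<close>

section \<open>The minimum kernel\<close>

lemma min_kernel_shift:
  fixes m x :: "'b \<Rightarrow> real"
  shows "(\<Sum>i\<in>I. \<Sum>j\<in>I. x i * x j * min (m i) (m j))
      = c * (\<Sum>i\<in>I. x i)\<^sup>2 + (\<Sum>i\<in>I. \<Sum>j\<in>I. x i * x j * min (m i - c) (m j - c))"
proof -
  have "x i * x j * min (m i) (m j)
      = c * (x i * x j) + x i * x j * min (m i - c) (m j - c)" for i j
    by (simp add: min_def algebra_simps)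
  moreover have "c * (\<Sum>i\<in>I. x i)\<^sup>2 = (\<Sum>i\<in>I. \<Sum>j\<in>I. c * (x i * x j))"
    by (simp only: power2_eq_square sum_product) (simp only: sum_distrib_left)
  ultimately show ?thesis
    by (simp only: sum.distrib)
qed

text \<open>
  Subtracting the smallest value \<open>c\<close> from all \<open>m i\<close> splits off the nonnegative term \<open>c (\<Sum> x i)\<^sup>2\<close> and
  kills every index where the minimum was attained, so that induction on the index set applies.
  This is the discrete form of writing \<open>min s t\<close> as the integral of \<open>[u < s] [u < t]\<close> over \<open>u \<ge> 0\<close>.
\<close>

lemma min_kernel_nonneg:
  fixes m x :: "'b \<Rightarrow> real"
  assumes "finite I" and "\<And>i. i \<in> I \<Longrightarrow> 0 \<le> m i"
  shows "0 \<le> (\<Sum>i\<in>I. \<Sum>j\<in>I. x i * x j * min (m i) (m j))"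
  using assms
proof (induction I arbitrary: m rule: finite_psubset_induct)
  case (psubset I)
  show ?case
  proof (cases "I = {}")
    case False
    define c where "c = Min (m ` I)"
    \<comment> \<open>the indices that survive after lowering everything by the minimum\<close>
    define J where "J = {i \<in> I. m i \<noteq> c}"
    have c_le: "c \<le> m i" if "i \<in> I" for i
      using that psubset.hyps(1) by (simp add: c_def)
    have "c \<in> m ` I"
      using False psubset.hyps(1) by (simp add: c_def)
    then have c_ge: "0 \<le> c" and JI: "J \<subset> I"
      using psubset.prems by (auto simp: J_def)
    have "(\<Sum>i\<in>I. \<Sum>j\<in>I. x i * x j * min (m i) (m j))
        = c * (\<Sum>i\<in>I. x i)\<^sup>2 + (\<Sum>i\<in>I. \<Sum>j\<in>I. x i * x j * min (m i - c) (m j - c))"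
      by (rule min_kernel_shift)
    also have "(\<Sum>i\<in>I. \<Sum>j\<in>I. x i * x j * min (m i - c) (m j - c))
        = (\<Sum>i\<in>J. \<Sum>j\<in>J. x i * x j * min (m i - c) (m j - c))"
    proof -
      have vanish: "x i * x j * min (m i - c) (m j - c) = 0"
        if "i \<in> I" "j \<in> I" "i \<notin> J \<or> j \<notin> J" for i j
        using that c_le[of i] c_le[of j] by (auto simp: J_def min_def)
      have inner: "(\<Sum>j\<in>I. x i * x j * min (m i - c) (m j - c))
          = (\<Sum>j\<in>J. x i * x j * min (m i - c) (m j - c))" if "i \<in> I" for i
        using psubset.hyps(1) JI vanish that by (intro sum.mono_neutral_right) auto
      have "(\<Sum>i\<in>I. \<Sum>j\<in>J. x i * x j * min (m i - c) (m j - c))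
          = (\<Sum>i\<in>J. \<Sum>j\<in>J. x i * x j * min (m i - c) (m j - c))"
        using psubset.hyps(1) JI vanish
        by (intro sum.mono_neutral_right) (auto intro!: sum.neutral)
      then show ?thesis
        using inner by simp
    qed
    finally have eq: "(\<Sum>i\<in>I. \<Sum>j\<in>I. x i * x j * min (m i) (m j))
        = c * (\<Sum>i\<in>I. x i)\<^sup>2 + (\<Sum>i\<in>J. \<Sum>j\<in>J. x i * x j * min (m i - c) (m j - c))" .
    have "0 \<le> (\<Sum>i\<in>J. \<Sum>j\<in>J. x i * x j * min (m i - c) (m j - c))"
      using JI c_le by (intro psubset.IH) auto
    then show ?thesis
      using eq c_ge by simp
  qed simp
qed

text \<open>
  On vectors of sum zero the kernel may be shifted by a constant, so \<open>m\<close> can be assumed nonnegative.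
\<close>

lemma min_kernel_nonneg_of_sum_zero:
  fixes m x :: "'b \<Rightarrow> real"
  assumes fin: "finite I" and sum0: "(\<Sum>i\<in>I. x i) = 0"
  shows "0 \<le> (\<Sum>i\<in>I. \<Sum>j\<in>I. x i * x j * min (m i) (m j))"
proof -
  define c where "c = Min (m ` I)"
  have "0 \<le> (\<Sum>i\<in>I. \<Sum>j\<in>I. x i * x j * min (m i - c) (m j - c))"
    using fin by (intro min_kernel_nonneg) (auto simp: c_def)
  then show ?thesis
    using min_kernel_shift[of x m I c] sum0 by simp
qed

section \<open>Strongly submodular functions\<close>

text \<open>
  The form in which strong submodularity meets Moebius inversion: the family of sets to be added
  consists of the singletons of \<open>T\<close>, so that index sets become subsets of \<open>T\<close>.
\<close>

lemma strongly_submodular_alternating_sum: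
  assumes f: "strongly_submodular Z f" and "A \<subseteq> Z" "T \<subseteq> Z" and fin: "finite T" and ne: "T \<noteq> {}"
  shows "(\<Sum>B\<in>Pow T. (-1) ^ card B * f (A \<union> B)) \<le> 0"
proof -
  obtain t where t: "bij_betw t {1..card T} T"
    using ex_bij_betw_nat_finite_1[OF fin] by blast
  define F where "F i = (if i = 0 then A else {t i})" for i :: nat
  have img: "bij_betw ((`) t) (Pow {1..card T}) (Pow T)"
    using bij_betw_Pow[OF t] .
  have sub: "\<forall>i\<le>card T. F i \<subseteq> Z"
  proof (intro allI impI)
    fix i assume "i \<le> card T"
    then show "F i \<subseteq> Z"
      using assms(2,3) bij_betwE[OF t] by (cases "i = 0") (auto simp: F_def)
  qed
  have "(\<Sum>B\<in>Pow T. (-1) ^ card B * f (A \<union> B))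
      = (\<Sum>K\<in>Pow {1..card T}. (-1) ^ card (t ` K) * f (A \<union> t ` K))"
    by (rule sum.reindex_bij_betw[OF img, symmetric])
  also have "\<dots> = (\<Sum>K\<in>Pow {1..card T}. (-1) ^ card K * f (F 0 \<union> (\<Union>i\<in>K. F i)))"
  proof (rule sum.cong[OF refl])
    fix K assume K: "K \<in> Pow {1..card T}"
    have "card (t ` K) = card K"
      using K bij_betw_imp_inj_on[OF t] by (intro card_image) (auto intro: inj_on_subset)
    moreover have "(\<Union>i\<in>K. F i) = t ` K"
      using K by (fastforce simp: F_def)
    ultimately show "(-1) ^ card (t ` K) * f (A \<union> t ` K)
        = (-1) ^ card K * f (F 0 \<union> (\<Union>i\<in>K. F i))"
      by (simp add: F_def)
  qed
  also have "\<dots> \<le> 0"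
    using f sub ne fin unfolding strongly_submodular_def
    by (metis One_nat_def Suc_leI card_gt_0_iff)
  finally show ?thesis .
qed

lemma strongly_submodular_mono:
  assumes f: "strongly_submodular Z f" and "A \<subseteq> B" "B \<subseteq> Z"
  shows "f A \<le> f B"
proof -
  show ?thesis
    using f[unfolded strongly_submodular_def, THEN spec[of _ 1], simplified,
        THEN spec[of _ "\<lambda>i. if i = 0 then A else B"]]
      assms(2,3) by (auto simp: Pow_insert Un_absorb1)
qed

lemma strongly_submodular_submodular:
  assumes f: "strongly_submodular Z f" and "A \<subseteq> Z" "B \<subseteq> Z" "C \<subseteq> Z"
  shows "f (A \<union> B \<union> C) + f B \<le> f (A \<union> B) + f (B \<union> C)"
proof -
  have "{1..2::nat} = {1, 2}"
    by auto
  then have pow: "Pow {1..2::nat} = {{}, {1}, {2}, {1, 2}}"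
    by (simp add: Pow_insert) auto
  show ?thesis
    using f[unfolded strongly_submodular_def, THEN spec[of _ 2], unfolded pow, simplified,
        THEN spec[of _ "\<lambda>i. if i = 0 then B else if i = 1 then A else C"]] assms(2-4)
    by (auto simp: Un_ac split: if_splits)
qed

text \<open>
  Moebius inversion for the superset order, obtained from the inversion formula for the subset order
  by passing to complements in \<open>X\<close>.  The alternating sum for \<open>h U\<close> starts at \<open>U\<close> and adds subsets of
  \<open>X - U\<close>; for \<open>U = X\<close> nothing is added, which is why \<open>h X = f X\<close> escapes the sign condition.
\<close>

lemma strongly_submodular_superset_expansion:
  assumes fin: "finite X" and f: "strongly_submodular X f"
  obtains h :: "'a set \<Rightarrow> real"
  where "\<And>U. U \<subset> X \<Longrightarrow> h U \<le> 0"
    and "\<And>A. A \<subseteq> X \<Longrightarrow> f A = (\<Sum>U\<in>Pow X. h U * of_bool (A \<subseteq> U))"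
proof
  define H where "H T = (\<Sum>C\<in>Pow T. (-1) ^ card C * f (X - C))" for T
  define h where "h U = (-1) ^ card (X - U) * H (X - U)" for U
  show "h U \<le> 0" if U: "U \<subset> X" for U
  proof -
    define T where "T = X - U"
    have finT: "finite T"
      using fin by (simp add: T_def)
    have "h U = (\<Sum>C\<in>Pow T. (-1) ^ card T * ((-1) ^ card C * f (X - C)))"
      by (simp add: h_def H_def T_def sum_distrib_left)
    also have "\<dots> = (\<Sum>B\<in>Pow T. (-1) ^ card T * ((-1) ^ card (T - B) * f (X - (T - B))))"
      by (rule sum.reindex_bij_witness[of _ "\<lambda>B. T - B" "\<lambda>B. T - B"])
        (auto simp: double_diff)
    also have "\<dots> = (\<Sum>B\<in>Pow T. (-1) ^ card B * f (U \<union> B))"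
    proof (rule sum.cong[OF refl])
      fix B assume B: "B \<in> Pow T"
      have "X - (T - B) = U \<union> B"
        using U B by (auto simp: T_def)
      moreover have "card T = card B + card (T - B)"
        using B finT by (metis Pow_iff card_Diff_subset card_mono finite_subset le_add_diff_inverse)
      ultimately show "(-1) ^ card T * ((-1) ^ card (T - B) * f (X - (T - B)))
          = (-1) ^ card B * f (U \<union> B)"
        by (simp add: power_add mult.assoc flip: power_mult_distrib)
    qed
    also have "\<dots> \<le> 0"
      using U finT by (intro strongly_submodular_alternating_sum[OF f]) (auto simp: T_def)
    finally show ?thesis .
  qed
  show "f A = (\<Sum>U\<in>Pow X. h U * of_bool (A \<subseteq> U))" if A: "A \<subseteq> X" for A
  proof -
    have "f A = f (X - (X - A))"
      using A by (simp add: double_diff)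
    also have "\<dots> = (\<Sum>T\<in>Pow (X - A). (-1) ^ card T * H T)"
      using fin by (intro inclusion_exclusion_symmetric[where f = "\<lambda>S. f (X - S)"]) (auto simp: H_def)
    also have "\<dots> = (\<Sum>U | U \<in> Pow X \<and> A \<subseteq> U. h U)"
      using A by (intro sum.reindex_bij_witness[of _ "\<lambda>U. X - U" "\<lambda>T. X - T"])
        (use A in \<open>auto simp: h_def double_diff Diff_Diff_Int Int_absorb1 subset_trans[OF _ Diff_subset]\<close>)
    also have "\<dots> = (\<Sum>U\<in>Pow X. h U * of_bool (A \<subseteq> U))"
      using fin by (intro sum.mono_neutral_cong_left) auto
    finally show ?thesis .
  qed
qed

text \<open>
  Each indicator \<open>[A \<union> B \<subseteq> U]\<close> is a rank-one kernel in \<open>A\<close> and \<open>B\<close>, so the expansion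
  diagonalizes the form into squares weighted by \<open>h U\<close>.
\<close>

lemma strongly_submodular_negative_definite:
  assumes fin: "finite X" and f: "strongly_submodular X f" and sum0: "(\<Sum>A\<in>Pow X. x A) = 0"
  shows "(\<Sum>A\<in>Pow X. \<Sum>B\<in>Pow X. x A * x B * f (A \<union> B)) \<le> 0"
proof -
  obtain h :: "'a set \<Rightarrow> real" where h: "\<And>U. U \<subset> X \<Longrightarrow> h U \<le> 0"
    and f_eq: "\<And>A. A \<subseteq> X \<Longrightarrow> f A = (\<Sum>U\<in>Pow X. h U * of_bool (A \<subseteq> U))"
    using strongly_submodular_superset_expansion[OF fin f] by blast
  define y where "y U A = x A * of_bool (A \<subseteq> U)" for U A
  have "(\<Sum>A\<in>Pow X. \<Sum>B\<in>Pow X. x A * x B * f (A \<union> B))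
      = (\<Sum>A\<in>Pow X. \<Sum>B\<in>Pow X. \<Sum>U\<in>Pow X. h U * (y U A * y U B))"
    by (intro sum.cong[OF refl])
      (auto simp: f_eq y_def sum_distrib_left intro!: sum.cong)
  also have "\<dots> = (\<Sum>A\<in>Pow X. \<Sum>U\<in>Pow X. \<Sum>B\<in>Pow X. h U * (y U A * y U B))"
    by (intro sum.cong[OF refl] sum.swap)
  also have "\<dots> = (\<Sum>U\<in>Pow X. \<Sum>A\<in>Pow X. \<Sum>B\<in>Pow X. h U * (y U A * y U B))"
    by (rule sum.swap)
  also have "\<dots> = (\<Sum>U\<in>Pow X. h U * (\<Sum>A\<in>Pow X. y U A)\<^sup>2)"
    by (simp only: power2_eq_square sum_product) (simp only: sum_distrib_left)
  also have "\<dots> \<le> 0"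
  proof (rule sum_nonpos)
    fix U assume "U \<in> Pow X"
    show "h U * (\<Sum>A\<in>Pow X. y U A)\<^sup>2 \<le> 0"
    proof (cases "U = X")
      case True
      then have "(\<Sum>A\<in>Pow X. y U A) = 0"
        using sum0 by (simp add: y_def)
      then show ?thesis by simp
    next
      case False
      then have "h U \<le> 0"
        using h \<open>U \<in> Pow X\<close> by blast
      then show ?thesis
        by (simp add: mult_nonpos_nonneg)
    qed
  qed
  finally show ?thesis .
qed

section \<open>Diversities from strongly submodular functions\<close>

text \<open>
  Monotonicity and submodularity give \<open>f (A \<union> C) \<le> f (A \<union> B) + f (B \<union> C) - f B\<close>.  For the minima,
  take a point \<open>a\<close> attaining the minimum over \<open>A \<union> C\<close> and any \<open>b \<in> B\<close>: one of \<open>A \<union> B\<close> and \<open>B \<union> C\<close>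
  contains \<open>a\<close>, the other contains \<open>b\<close>, and \<open>f {b} \<le> f B\<close> pays for the second minimum.
\<close>

lemma diversity_delta:
  assumes fin: "finite X" and f: "strongly_submodular X f"
  shows "diversity X (delta f)"
proof
  fix A :: "'a set"
  assume A: "finite A" "A \<subseteq> X" "card A \<le> 1"
  then consider "A = {}" | a where "A = {a}"
    by (metis card_0_eq card_1_singletonE le_SucE le_zero_eq One_nat_def)
  then show "delta f A = 0"
    by cases (auto simp: delta_def)
next
  fix A B C :: "'a set"
  assume fins: "finite A" "finite B" "finite C" and sub: "A \<subseteq> X" "B \<subseteq> X" "C \<subseteq> X" and "B \<noteq> {}"
  define \<mu> where "\<mu> D = Min ((\<lambda>a. f {a}) ` D)" for D
  have \<mu>_le: "\<mu> D \<le> f {a}" if "finite D" "a \<in> D" for D a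
    using that by (simp add: \<mu>_def)
  obtain b where b: "b \<in> B"
    using \<open>B \<noteq> {}\<close> by blast
  then have fb: "f {b} \<le> f B"
    using strongly_submodular_mono[OF f] sub by simp
  have delta_AB: "delta f (A \<union> B) = f (A \<union> B) - \<mu> (A \<union> B)"
    and delta_BC: "delta f (B \<union> C) = f (B \<union> C) - \<mu> (B \<union> C)"
    using \<open>B \<noteq> {}\<close> by (simp_all add: delta_def \<mu>_def)
  show "delta f (A \<union> C) \<le> delta f (A \<union> B) + delta f (B \<union> C)"
  proof (cases "A \<union> C = {}")
    case True
    then show ?thesis
      using delta_AB fb \<mu>_le[OF fins(2) b] by (simp add: delta_def)
  next
    case False
    then have delta_AC: "delta f (A \<union> C) = f (A \<union> C) - \<mu> (A \<union> C)"
      unfolding delta_def \<mu>_def by (simp only: if_False)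
    have "\<mu> (A \<union> C) \<in> (\<lambda>a. f {a}) ` (A \<union> C)"
      unfolding \<mu>_def using False fins by (intro Min_in) auto
    then obtain a where a: "a \<in> A \<union> C" "\<mu> (A \<union> C) = f {a}"
      by blast
    have "\<mu> (A \<union> B) + \<mu> (B \<union> C) \<le> f {a} + f {b}"
    proof (cases "a \<in> A")
      case True
      then show ?thesis
        using \<mu>_le[of "A \<union> B" a] \<mu>_le[of "B \<union> C" b] b fins by simp
    next
      case False
      then show ?thesis
        using \<mu>_le[of "A \<union> B" b] \<mu>_le[of "B \<union> C" a] a b fins by simp
    qed
    moreover have "f (A \<union> C) \<le> f (A \<union> B \<union> C)"
      using sub by (intro strongly_submodular_mono[OF f]) auto
    moreover have "f (A \<union> B \<union> C) + f B \<le> f (A \<union> B) + f (B \<union> C)"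
      using strongly_submodular_submodular[OF f] sub by blast
    ultimately show ?thesis
      using delta_AB delta_BC delta_AC a(2) fb by linarith
  qed
qed

lemma negative_type_delta:
  assumes fin: "finite X" and f: "strongly_submodular X f"
  shows "negative_type X (delta f)"
  unfolding negative_type_def
proof (intro allI impI, elim conjE)
  fix x :: "'a set \<Rightarrow> real"
  assume x0: "x {} = 0" and "(\<Sum>A\<in>Pow X - {{}}. x A) = 0"
  then have sum0: "(\<Sum>A\<in>Pow X. x A) = 0"
    using fin sum.remove[of "Pow X" "{}" x] by simp
  define \<mu> where "\<mu> D = Min ((\<lambda>a. f {a}) ` D)" for D
  \<comment> \<open>If \<open>A\<close> or \<open>B\<close> is empty, then \<open>\<mu>\<close> has an arbitrary value there, but \<open>x {} = 0\<close> removes the term.\<close>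
  have "x A * x B * delta f (A \<union> B) = x A * x B * f (A \<union> B) - x A * x B * min (\<mu> A) (\<mu> B)"
    if "A \<in> Pow X" "B \<in> Pow X" for A B
  proof (cases "A = {} \<or> B = {}")
    case False
    then have "\<mu> (A \<union> B) = min (\<mu> A) (\<mu> B)"
      unfolding \<mu>_def image_Un using that fin
      by (subst Min_Un) (auto intro: finite_subset)
    then show ?thesis
      using False by (simp add: delta_def \<mu>_def right_diff_distrib)
  qed (auto simp: x0)
  then have "(\<Sum>A\<in>Pow X. \<Sum>B\<in>Pow X. x A * x B * delta f (A \<union> B))
      = (\<Sum>A\<in>Pow X. \<Sum>B\<in>Pow X. x A * x B * f (A \<union> B))
        - (\<Sum>A\<in>Pow X. \<Sum>B\<in>Pow X. x A * x B * min (\<mu> A) (\<mu> B))"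
    by (simp add: sum_subtractf)
  also have "\<dots> \<le> 0"
    using strongly_submodular_negative_definite[OF fin f sum0]
      min_kernel_nonneg_of_sum_zero[of "Pow X" x \<mu>] fin sum0 by simp
  finally show "(\<Sum>A\<in>Pow X. \<Sum>B\<in>Pow X. x A * x B * delta f (A \<union> B)) \<le> 0" .
qed

lemma strongly_submodular_ignore_point:
  assumes g: "strongly_submodular (X - {x}) g"
  shows "strongly_submodular X (\<lambda>A. g (A - {x}))"
  unfolding strongly_submodular_def
proof (intro allI impI)
  fix m :: nat and A :: "nat \<Rightarrow> 'a set"
  assume m: "1 \<le> m" and A: "\<forall>i\<le>m. A i \<subseteq> X"
  have "(\<Sum>K\<in>Pow {1..m}. (-1) ^ card K * g ((A 0 - {x}) \<union> (\<Union>i\<in>K. A i - {x}))) \<le> 0"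
    using g[unfolded strongly_submodular_def, rule_format, OF m, of "\<lambda>i. A i - {x}"] A by blast
  moreover have "(A 0 - {x}) \<union> (\<Union>i\<in>K. A i - {x}) = A 0 \<union> (\<Union>i\<in>K. A i) - {x}" for K
    by blast
  ultimately show "(\<Sum>K\<in>Pow {1..m}. (-1) ^ card K * g (A 0 \<union> (\<Union>i\<in>K. A i) - {x})) \<le> 0"
    by (simp only:)
qed

lemma delta_hat_eq_delta:
  assumes g: "strongly_submodular (X - {x}) g" and g0: "g {} = 0" and fin: "finite A" and sub: "A \<subseteq> X"
  shows "delta_hat x g A = delta (\<lambda>A. g (A - {x})) A"
proof (cases "x \<in> A")
  case True
  have nonneg: "0 \<le> g ({a} - {x})" if "a \<in> A" for a
    using strongly_submodular_mono[OF g, of "{}" "{a} - {x}"] g0 sub that by auto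
  have "Min ((\<lambda>a. g ({a} - {x})) ` A) = 0"
    using True fin nonneg g0 by (intro Min_eqI) (auto intro!: rev_image_eqI[of x])
  then show ?thesis
    using True by (auto simp: delta_hat_def delta_def)
next
  case False
  then have "(\<lambda>a. g ({a} - {x})) ` A = (\<lambda>a. g {a}) ` A"
    by (intro image_cong arg_cong[where f = g]) auto
  then show ?thesis
    using False by (simp add: delta_hat_def delta_def)
qed

lemma diversity_cong:
  assumes "diversity X \<delta>" and "\<And>A. finite A \<Longrightarrow> A \<subseteq> X \<Longrightarrow> \<delta>' A = \<delta> A"
  shows "diversity X \<delta>'"
proof -
  interpret diversity X \<delta>
    by (rule assms(1))
  show ?thesis
  proof
    show "\<delta>' A = 0" if "finite A" "A \<subseteq> X" "card A \<le> 1" for A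
      using D1 assms(2) that by simp
    show "\<delta>' (A \<union> C) \<le> \<delta>' (A \<union> B) + \<delta>' (B \<union> C)"
      if "finite A" "A \<subseteq> X" "finite B" "B \<subseteq> X" "finite C" "C \<subseteq> X" "B \<noteq> {}" for A B C
      using D2[OF that] that by (simp add: assms(2))
  qed
qed

lemma negative_type_cong:
  assumes "negative_type X \<delta>" and "\<And>A. A \<subseteq> X \<Longrightarrow> \<delta>' A = \<delta> A"
  shows "negative_type X \<delta>'"
proof -
  have "(\<Sum>A\<in>Pow X. \<Sum>B\<in>Pow X. x A * x B * \<delta>' (A \<union> B))
      = (\<Sum>A\<in>Pow X. \<Sum>B\<in>Pow X. x A * x B * \<delta> (A \<union> B))" for x :: "'a set \<Rightarrow> real"
    by (intro sum.cong refl) (simp add: assms(2))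
  then show ?thesis
    using assms(1) by (simp only: negative_type_def)
qed

theorem proposition7:
  fixes X :: "'a set"
  assumes "finite X"
  shows "(\<forall>f :: 'a set \<Rightarrow> real. strongly_submodular X f \<longrightarrow>
            diversity X (delta f) \<and> negative_type X (delta f)) \<and>
         (\<forall>x\<in>X. \<forall>g :: 'a set \<Rightarrow> real. strongly_submodular (X - {x}) g \<and> g {} = 0 \<longrightarrow>
            diversity X (delta_hat x g) \<and> negative_type X (delta_hat x g))"
proof (intro conjI allI ballI impI)
  fix f :: "'a set \<Rightarrow> real"
  assume f: "strongly_submodular X f"
  show "diversity X (delta f)" "negative_type X (delta f)"
    using diversity_delta negative_type_delta assms f by blast+
next
  fix x and g :: "'a set \<Rightarrow> real"
  assume "x \<in> X" and g: "strongly_submodular (X - {x}) g \<and> g {} = 0"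
  let ?f = "\<lambda>A. g (A - {x})"
  have f: "strongly_submodular X ?f"
    using g by (intro strongly_submodular_ignore_point) simp
  have eq: "delta_hat x g A = delta ?f A" if "A \<subseteq> X" for A
    using g that assms by (intro delta_hat_eq_delta) (auto intro: finite_subset)
  show "diversity X (delta_hat x g)"
    using diversity_delta[OF assms f] by (rule diversity_cong) (rule eq)
  show "negative_type X (delta_hat x g)"
    using negative_type_delta[OF assms f] by (rule negative_type_cong) (rule eq)
qed

end
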